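(* For any sufficiently small $\lambda > 0$, there exists an interval $(2 + \lambda - \varepsilon, 2 + \lambda)$, $\varepsilon > 0$, such that for any $E \in (2 + \lambda - \varepsilon, 2 + \lambda)$, there exists a bi-infinite sequence $V \in \{0, \lambda\}^{\mathbb{Z}}$ such that, for the Schrödinger operator $H$ on $\ell^2(\mathbb{Z})$ with potential $V$, $E$ is the maximal energy in the spectrum of $H$, $E$ is an eigenvalue of $H$, and the corresponding eigenfunction is exponentially decaying and (up to a multiplicative constant) has strictly positive components.
   Context: The (discrete, one-dimensional) Schrödinger operator with potential $V : \mathbb{Z} \to \mathbb{R}$ acts on $\ell^2(\mathbb{Z})$ by $[H\psi](n) = \psi(n+1) + \psi(n-1) + V(n)\psi(n)$. Exponentially decaying means that $|\psi(n)| \le A e^{-\kappa |n|}$ for all $n \in \mathbb{Z}$ with some constants $A, \kappa > 0$. *)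

theory Defs
  imports "HOL-Analysis.Analysis"
begin

definition l2 :: "(int \<Rightarrow> complex) set" where
  "l2 = {\<psi>. (\<lambda>n. (cmod (\<psi> n))\<^sup>2) summable_on UNIV}"

definition l2_norm :: "(int \<Rightarrow> complex) \<Rightarrow> real" where
  "l2_norm \<psi> = sqrt (\<Sum>\<^sub>\<infinity>n. (cmod (\<psi> n))\<^sup>2)"

definition schroedinger :: "(int \<Rightarrow> real) \<Rightarrow> (int \<Rightarrow> complex) \<Rightarrow> (int \<Rightarrow> complex)" where
  "schroedinger V \<psi> = (\<lambda>n. \<psi> (n + 1) + \<psi> (n - 1) + of_real (V n) * \<psi> n)"

(* Resolvent set and spectrum of an operator on l2, given as a map on all sequences that is
   only ever applied to elements of l2. The second conjunct says that the inverse of T - z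
   on l2 is bounded. *)
definition l2_resolvent_set :: "((int \<Rightarrow> complex) \<Rightarrow> (int \<Rightarrow> complex)) \<Rightarrow> complex set" where
  "l2_resolvent_set T =
     {z. bij_betw (\<lambda>\<psi> n. T \<psi> n - z * \<psi> n) l2 l2 \<and>
         (\<exists>C. \<forall>\<psi>\<in>l2. l2_norm \<psi> \<le> C * l2_norm (\<lambda>n. T \<psi> n - z * \<psi> n))}"

definition l2_spectrum :: "((int \<Rightarrow> complex) \<Rightarrow> (int \<Rightarrow> complex)) \<Rightarrow> complex set" where
  "l2_spectrum T = - l2_resolvent_set T"

definition l2_eigenfunction ::
    "((int \<Rightarrow> complex) \<Rightarrow> (int \<Rightarrow> complex)) \<Rightarrow> complex \<Rightarrow> (int \<Rightarrow> complex) \<Rightarrow> bool" where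
  "l2_eigenfunction T z \<psi> \<longleftrightarrow>
     \<psi> \<in> l2 \<and> \<psi> \<noteq> (\<lambda>n. 0) \<and> T \<psi> = (\<lambda>n. z * \<psi> n)"

definition l2_eigenvalue :: "((int \<Rightarrow> complex) \<Rightarrow> (int \<Rightarrow> complex)) \<Rightarrow> complex \<Rightarrow> bool" where
  "l2_eigenvalue T z \<longleftrightarrow> (\<exists>\<psi>. l2_eigenfunction T z \<psi>)"

(* E is the maximum of the spectrum. For a self-adjoint T the spectrum is real, and
   "Re z \<le> E" is then just "z \<le> E"; phrasing it with Re bounds every spectral point. *)
definition max_energy :: "((int \<Rightarrow> complex) \<Rightarrow> (int \<Rightarrow> complex)) \<Rightarrow> real \<Rightarrow> bool" where
  "max_energy T E \<longleftrightarrow>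
     complex_of_real E \<in> l2_spectrum T \<and> (\<forall>z\<in>l2_spectrum T. Re z \<le> E)"

definition exponentially_decaying :: "(int \<Rightarrow> complex) \<Rightarrow> bool" where
  "exponentially_decaying \<psi> \<longleftrightarrow>
     (\<exists>A>0. \<exists>\<kappa>>0. \<forall>n. cmod (\<psi> n) \<le> A * exp (- \<kappa> * \<bar>real_of_int n\<bar>))"

definition positive_up_to_constant :: "(int \<Rightarrow> complex) \<Rightarrow> bool" where
  "positive_up_to_constant \<psi> \<longleftrightarrow>
     (\<exists>c p. c \<noteq> 0 \<and> (\<forall>n. p n > 0) \<and> \<psi> = (\<lambda>n. c * complex_of_real (p n)))"

end

theory Submission
  imports Defs
begin

text \<open>
  The potential is found by steering the ratios \<open>r\<^sub>n = \<psi>(n+1) / \<psi>(n)\<close> of a positive solution, which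
  obey \<open>r\<^sub>n = E - V(n) - 1 / r\<^sub>n\<^sub>-\<^sub>1\<close>.  Since \<open>E > 2\<close>, there is \<open>a \<in> (0,1)\<close> with \<open>a + 1/a = E\<close>.
  On the left \<open>V = 0\<close> and \<open>\<psi>(n) = a\<^sup>-\<^sup>n\<close> decays, with ratio \<open>1/a\<close>; for decay on the right the ratio has to
  be brought below 1 and kept there.  A step with \<open>V = 0\<close> does not decrease a ratio in \<open>[a, 1/a]\<close>,
  as \<open>r + 1/r \<le> E\<close> there, and a step with \<open>V = \<lambda>\<close> decreases it by at least \<open>2 + \<lambda> - E > 0\<close>,
  as \<open>r + 1/r \<ge> 2\<close>.  The two possible new ratios differ by exactly \<open>\<lambda>\<close>, so choosing
  \<open>V = 0\<close> precisely when this gives a ratio of at most \<open>a + \<lambda>\<close> never leads below \<open>a\<close>.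
  Hence the ratio descends into \<open>[a, a + \<lambda>]\<close> after finitely many steps and stays there
  (\<open>ratio_trapped\<close>).  For small \<open>\<lambda>\<close> and \<open>E\<close> near \<open>2 + \<lambda>\<close> one has \<open>a \<approx> 1 - \<surd>\<lambda>\<close>, so that
  \<open>a + \<lambda> < 1\<close> and \<open>\<psi>\<close> decays exponentially on both sides.

  That \<open>E\<close> is the top of the spectrum is due to the positivity of \<open>\<psi>\<close>: the matrix of \<open>H\<close> is symmetric
  with nonnegative entries, so the Schur test with weight \<open>\<psi>\<close> gives \<open>\<parallel>H\<parallel> \<le> E\<close> (\<open>schur_test\<close>),
  and the Neumann series inverts \<open>H - z\<close> whenever \<open>\<bar>z\<bar> > E\<close>, in particular whenever
  \<open>Re z > E\<close>.  Finally, the Wronskian of \<open>\<psi>\<close> with any other square summable solution is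
  constant and tends to 0, so the eigenspace is spanned by \<open>\<psi>\<close> (\<open>eigenfunction_unique\<close>).
\<close>

section \<open>Square summable sequences\<close>

lemma l2_norm_nonneg: "0 \<le> l2_norm \<phi>"
  unfolding l2_norm_def by (simp add: infsum_nonneg)

lemma L2_set_le_l2_norm:
  assumes "\<phi> \<in> l2" "finite F"
  shows "L2_set (\<lambda>n. cmod (\<phi> n)) F \<le> l2_norm \<phi>"
  using assms unfolding l2_def l2_norm_def L2_set_def
  by (auto intro!: real_sqrt_le_mono finite_sum_le_infsum)

text \<open>Membership in \<open>l2\<close> and norm bounds are both obtained by bounding finite sections, where the
  triangle inequality and limits are available.\<close>

lemma l2_finite_sections:
  assumes "\<And>F. finite F \<Longrightarrow> L2_set (\<lambda>n. cmod (\<phi> n)) F \<le> B"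
  shows "\<phi> \<in> l2" "l2_norm \<phi> \<le> B"
proof -
  have B: "0 \<le> B" using assms[of "{}"] by simp
  have fin: "(\<Sum>n\<in>F. (cmod (\<phi> n))\<^sup>2) \<le> B\<^sup>2" if "finite F" for F
    using assms[OF that] B unfolding L2_set_def by (simp add: sqrt_le_D)
  have *: "(\<lambda>n. (cmod (\<phi> n))\<^sup>2) summable_on UNIV"
    by (rule nonneg_bounded_partial_sums_imp_summable_on[where C = "B\<^sup>2"])
      (auto intro!: eventually_finite_subsets_at_top_weakI fin)
  then show "\<phi> \<in> l2" by (simp add: l2_def)
  have "(\<Sum>\<^sub>\<infinity>n. (cmod (\<phi> n))\<^sup>2) \<le> B\<^sup>2"
    by (rule infsum_le_finite_sums[OF *]) (use fin in auto)
  then show "l2_norm \<phi> \<le> B"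
    unfolding l2_norm_def using B real_le_lsqrt by blast
qed

lemma cmod_le_l2_norm:
  assumes "\<phi> \<in> l2"
  shows "cmod (\<phi> n) \<le> l2_norm \<phi>"
  using L2_set_le_l2_norm[OF assms, of "{n}"] by simp

lemma l2_zero: "(\<lambda>n. 0) \<in> l2"
  by (simp add: l2_def)

lemma l2_add:
  assumes "\<phi> \<in> l2" "\<eta> \<in> l2"
  shows "(\<lambda>n. \<phi> n + \<eta> n) \<in> l2" "l2_norm (\<lambda>n. \<phi> n + \<eta> n) \<le> l2_norm \<phi> + l2_norm \<eta>"
proof -
  have "L2_set (\<lambda>n. cmod (\<phi> n + \<eta> n)) F \<le> l2_norm \<phi> + l2_norm \<eta>" if "finite F" for F
  proof -
    have "L2_set (\<lambda>n. cmod (\<phi> n + \<eta> n)) F \<le> L2_set (\<lambda>n. cmod (\<phi> n) + cmod (\<eta> n)) F"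
      by (intro L2_set_mono norm_triangle_ineq) auto
    also have "\<dots> \<le> L2_set (\<lambda>n. cmod (\<phi> n)) F + L2_set (\<lambda>n. cmod (\<eta> n)) F"
      by (rule L2_set_triangle_ineq)
    also have "\<dots> \<le> l2_norm \<phi> + l2_norm \<eta>"
      by (intro add_mono L2_set_le_l2_norm assms that)
    finally show ?thesis .
  qed
  from l2_finite_sections[OF this]
  show "(\<lambda>n. \<phi> n + \<eta> n) \<in> l2" "l2_norm (\<lambda>n. \<phi> n + \<eta> n) \<le> l2_norm \<phi> + l2_norm \<eta>"
    by auto
qed

lemma l2_scale:
  assumes "\<phi> \<in> l2"
  shows "(\<lambda>n. c * \<phi> n) \<in> l2" "l2_norm (\<lambda>n. c * \<phi> n) = cmod c * l2_norm \<phi>"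
proof -
  show "(\<lambda>n. c * \<phi> n) \<in> l2"
    using assms unfolding l2_def
    by (auto simp: norm_mult power_mult_distrib intro: summable_on_cmult_right)
  show "l2_norm (\<lambda>n. c * \<phi> n) = cmod c * l2_norm \<phi>"
    unfolding l2_norm_def
    by (simp add: norm_mult power_mult_distrib infsum_cmult_right' real_sqrt_mult)
qed

lemma l2_diff:
  assumes "\<phi> \<in> l2" "\<eta> \<in> l2"
  shows "(\<lambda>n. \<phi> n - \<eta> n) \<in> l2"
  using l2_add(1)[OF assms(1) l2_scale(1)[OF assms(2), of "-1"]] by simp

text \<open>Absolute convergence in norm gives a pointwise sum that lies in \<open>l2\<close>; this form of completeness
  is all that the Neumann series requires.\<close>

lemma l2_suminf:
  assumes u: "\<And>k. u k \<in> l2" and s: "summable (\<lambda>k. l2_norm (u k))"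
  shows "summable (\<lambda>k. u k n)" "(\<lambda>n. \<Sum>k. u k n) \<in> l2"
proof -
  have sm: "summable (\<lambda>k. u k n)" for n
    by (rule summable_comparison_test'[OF s]) (use cmod_le_l2_norm[OF u] in auto)
  then show "summable (\<lambda>k. u k n)" .
  have part: "(\<lambda>n. \<Sum>k<N. u k n) \<in> l2 \<and>
      l2_norm (\<lambda>n. \<Sum>k<N. u k n) \<le> (\<Sum>k<N. l2_norm (u k))" for N
  proof (induction N)
    case 0
    then show ?case by (simp add: l2_zero l2_norm_def)
  next
    case (Suc N)
    then show ?case
      using l2_add[of "\<lambda>n. \<Sum>k<N. u k n" "u N"] u[of N] by auto
  qed
  have "L2_set (\<lambda>n. cmod (\<Sum>k. u k n)) F \<le> (\<Sum>k. l2_norm (u k))" if F: "finite F" for F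
  proof (rule tendsto_upperbound)
    show "(\<lambda>N. L2_set (\<lambda>n. cmod (\<Sum>k<N. u k n)) F)
        \<longlonglongrightarrow> L2_set (\<lambda>n. cmod (\<Sum>k. u k n)) F"
      unfolding L2_set_def
      by (intro tendsto_intros summable_LIMSEQ sm)
    have "L2_set (\<lambda>n. cmod (\<Sum>k<N. u k n)) F \<le> (\<Sum>k. l2_norm (u k))" for N
      using L2_set_le_l2_norm[OF conjunct1[OF part[of N]] F] part[of N]
        sum_le_suminf[OF s, of "{..<N}"] l2_norm_nonneg by fastforce
    then show "\<forall>\<^sub>F N in sequentially.
        L2_set (\<lambda>n. cmod (\<Sum>k<N. u k n)) F \<le> (\<Sum>k. l2_norm (u k))" by simp
  qed simp
  from l2_finite_sections(1)[OF this] show "(\<lambda>n. \<Sum>k. u k n) \<in> l2" .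
qed

section \<open>Norm bound and resolvent\<close>

text \<open>The Schur test: by Cauchy-Schwarz with weights \<open>p\<close>,
  \<open>\<bar>H\<phi>(n)\<bar>\<^sup>2 \<le> E p(n) \<Sum>\<^sub>m H\<^sub>n\<^sub>m \<bar>\<phi>(m)\<bar>\<^sup>2 / p(m)\<close>, and summing over \<open>n\<close> first applies the equation for \<open>p\<close>
  once more, by the symmetry of \<open>H\<close>.\<close>

lemma schur_test:
  fixes p V :: "int \<Rightarrow> real"
  assumes p: "\<And>n. 0 < p n" and V: "\<And>n. 0 \<le> V n" and E: "0 \<le> E"
    and eq: "\<And>n. p (n + 1) + p (n - 1) + V n * p n = E * p n"
    and \<phi>: "\<phi> \<in> l2"
  shows "schroedinger V \<phi> \<in> l2" "l2_norm (schroedinger V \<phi>) \<le> E * l2_norm \<phi>"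
proof -
  define g where "g = (\<lambda>n. (cmod (\<phi> n))\<^sup>2 / p n)"
  have g0: "0 \<le> g n" for n unfolding g_def using p[of n] by simp
  \<comment> \<open>Weighted Cauchy-Schwarz for three terms, by Lagrange's identity.\<close>
  have cs: "(x * X + y * Y + v * Z)\<^sup>2 \<le> (X + Y + v * w) * (x\<^sup>2 * X + y\<^sup>2 * Y + v * (Z\<^sup>2 / w))"
    if "0 < X" "0 < Y" "0 < w" "0 \<le> v" for x y v w X Y Z :: real
  proof -
    define t where "t = Z / w"
    have Z: "Z = t * w" "Z\<^sup>2 / w = t\<^sup>2 * w"
      using that by (auto simp: t_def power2_eq_square)
    have "(X + Y + v * w) * (x\<^sup>2 * X + y\<^sup>2 * Y + v * (Z\<^sup>2 / w)) - (x * X + y * Y + v * Z)\<^sup>2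
      = X * Y * (x - y)\<^sup>2 + v * X * w * (x - t)\<^sup>2 + v * Y * w * (y - t)\<^sup>2"
      unfolding Z(2) unfolding Z(1) by (simp add: power2_eq_square algebra_simps)
    moreover have "\<dots> \<ge> 0" using that by simp
    ultimately show ?thesis by linarith
  qed
  have pt: "(cmod (schroedinger V \<phi> n))\<^sup>2
      \<le> E * (p n * g (n + 1) + p n * g (n - 1) + V n * p n * g n)" for n
  proof -
    define x where "x = cmod (\<phi> (n + 1)) / p (n + 1)"
    define y where "y = cmod (\<phi> (n - 1)) / p (n - 1)"
    have "cmod (schroedinger V \<phi> n)
        \<le> cmod (\<phi> (n + 1)) + cmod (\<phi> (n - 1)) + cmod (of_real (V n) * \<phi> n)"
      unfolding schroedinger_def by (meson norm_triangle_ineq norm_triangle_mono order_refl)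
    also have "\<dots> = x * p (n + 1) + y * p (n - 1) + V n * cmod (\<phi> n)"
      using p[of "n + 1"] p[of "n - 1"] V[of n] by (simp add: x_def y_def norm_mult)
    finally have "(cmod (schroedinger V \<phi> n))\<^sup>2
        \<le> (x * p (n + 1) + y * p (n - 1) + V n * cmod (\<phi> n))\<^sup>2"
      by (simp add: power_mono)
    also have "\<dots> \<le> (p (n + 1) + p (n - 1) + V n * p n) *
        (x\<^sup>2 * p (n + 1) + y\<^sup>2 * p (n - 1) + V n * ((cmod (\<phi> n))\<^sup>2 / p n))"
      by (rule cs) (use p V in auto)
    also have "\<dots> = (E * p n) * (g (n + 1) + g (n - 1) + V n * g n)"
    proof -
      have "x\<^sup>2 * p (n + 1) = g (n + 1)" "y\<^sup>2 * p (n - 1) = g (n - 1)"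
        using p[of "n + 1"] p[of "n - 1"]
        by (simp_all add: x_def y_def g_def field_simps power2_eq_square)
      then show ?thesis by (simp add: eq g_def)
    qed
    finally show ?thesis by (simp add: algebra_simps)
  qed
  have "L2_set (\<lambda>n. cmod (schroedinger V \<phi> n)) F \<le> E * l2_norm \<phi>" if F: "finite F" for F
  proof -
    \<comment> \<open>Shifting the index by one moves \<open>F\<close>; \<open>G\<close> contains all three translates that occur.\<close>
    define G where "G = F \<union> (\<lambda>n. n + 1) ` F \<union> (\<lambda>n. n - 1) ` F"
    have G: "finite G" using F by (simp add: G_def)
    have s1: "(\<Sum>n\<in>F. p n * g (n + 1)) \<le> (\<Sum>m\<in>G. p (m - 1) * g m)"
    proof -
      have "(\<Sum>n\<in>F. p n * g (n + 1)) = (\<Sum>m\<in>(\<lambda>n. n + 1) ` F. p (m - 1) * g m)"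
        by (simp add: sum.reindex)
      also have "\<dots> \<le> (\<Sum>m\<in>G. p (m - 1) * g m)"
        by (rule sum_mono2[OF G]) (auto simp: G_def intro: mult_nonneg_nonneg less_imp_le[OF p] g0)
      finally show ?thesis .
    qed
    have s2: "(\<Sum>n\<in>F. p n * g (n - 1)) \<le> (\<Sum>m\<in>G. p (m + 1) * g m)"
    proof -
      have "(\<Sum>n\<in>F. p n * g (n - 1)) = (\<Sum>m\<in>(\<lambda>n. n - 1) ` F. p (m + 1) * g m)"
        by (simp add: sum.reindex inj_on_def)
      also have "\<dots> \<le> (\<Sum>m\<in>G. p (m + 1) * g m)"
        by (rule sum_mono2[OF G]) (auto simp: G_def intro: mult_nonneg_nonneg less_imp_le[OF p] g0)
      finally show ?thesis .
    qed
    have s3: "(\<Sum>n\<in>F. V n * p n * g n) \<le> (\<Sum>m\<in>G. V m * p m * g m)"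
      by (rule sum_mono2[OF G]) (auto simp: G_def intro: mult_nonneg_nonneg less_imp_le[OF p] g0 V)
    have "(\<Sum>n\<in>F. (cmod (schroedinger V \<phi> n))\<^sup>2)
        \<le> (\<Sum>n\<in>F. E * (p n * g (n + 1) + p n * g (n - 1) + V n * p n * g n))"
      by (rule sum_mono) (rule pt)
    also have "\<dots> = E * ((\<Sum>n\<in>F. p n * g (n + 1)) + (\<Sum>n\<in>F. p n * g (n - 1))
        + (\<Sum>n\<in>F. V n * p n * g n))"
      by (simp add: sum.distrib flip: sum_distrib_left)
    also have "\<dots> \<le> E * ((\<Sum>m\<in>G. p (m - 1) * g m) + (\<Sum>m\<in>G. p (m + 1) * g m)
        + (\<Sum>m\<in>G. V m * p m * g m))"
      by (intro mult_left_mono add_mono s1 s2 s3 E)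
    also have "\<dots> = E * (\<Sum>m\<in>G. (p (m + 1) + p (m - 1) + V m * p m) * g m)"
      by (simp add: sum.distrib algebra_simps)
    also have "\<dots> = E * (\<Sum>m\<in>G. E * (cmod (\<phi> m))\<^sup>2)"
    proof -
      have "(p (m + 1) + p (m - 1) + V m * p m) * g m = E * (cmod (\<phi> m))\<^sup>2" for m
        unfolding eq g_def using p[of m] by simp
      then show ?thesis by simp
    qed
    also have "\<dots> = E\<^sup>2 * (\<Sum>m\<in>G. (cmod (\<phi> m))\<^sup>2)"
      by (simp add: power2_eq_square flip: sum_distrib_left)
    finally have "L2_set (\<lambda>n. cmod (schroedinger V \<phi> n)) F \<le> E * L2_set (\<lambda>n. cmod (\<phi> n)) G"
      unfolding L2_set_def using E by (metis real_sqrt_abs real_sqrt_le_mono real_sqrt_mult abs_of_nonneg)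
    also have "\<dots> \<le> E * l2_norm \<phi>"
      by (intro mult_left_mono L2_set_le_l2_norm \<phi> G E)
    finally show ?thesis .
  qed
  from l2_finite_sections[OF this]
  show "schroedinger V \<phi> \<in> l2" "l2_norm (schroedinger V \<phi>) \<le> E * l2_norm \<phi>" by auto
qed

text \<open>The inverse of \<open>H - z\<close> is the Neumann series \<open>-\<Sum>\<^sub>k H\<^sup>k / z\<^sup>k\<^sup>+\<^sup>1\<close>.  It can be summed pointwise,
  since every value of \<open>H\<phi>\<close> depends on three values of \<open>\<phi>\<close> only.\<close>

lemma resolvent_outside_norm_disc:
  assumes H: "\<And>\<phi>. \<phi> \<in> l2 \<Longrightarrow> schroedinger V \<phi> \<in> l2"
    and bd: "\<And>\<phi>. \<phi> \<in> l2 \<Longrightarrow> l2_norm (schroedinger V \<phi>) \<le> M * l2_norm \<phi>"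
    and M: "0 \<le> M" "M < cmod z"
  shows "z \<in> l2_resolvent_set (schroedinger V)"
proof -
  define A where "A = (\<lambda>\<phi> n. schroedinger V \<phi> n - z * \<phi> n)"
  have z: "z \<noteq> 0" using M by auto
  have A_l2: "A \<phi> \<in> l2" if "\<phi> \<in> l2" for \<phi>
    unfolding A_def by (intro l2_diff H l2_scale that)
  have below: "(cmod z - M) * l2_norm \<phi> \<le> l2_norm (A \<phi>)" if \<phi>: "\<phi> \<in> l2" for \<phi>
  proof -
    have "l2_norm (\<lambda>n. z * \<phi> n) = l2_norm (\<lambda>n. schroedinger V \<phi> n + (-1) * A \<phi> n)"
      by (rule arg_cong[where f = l2_norm]) (auto simp: A_def)
    also have "\<dots> \<le> M * l2_norm \<phi> + l2_norm (A \<phi>)"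
      using l2_add(2)[OF H[OF \<phi>] l2_scale(1)[OF A_l2[OF \<phi>], of "-1"]]
        l2_scale(2)[OF A_l2[OF \<phi>], of "-1"] bd[OF \<phi>] by simp
    finally show ?thesis by (simp add: l2_scale(2)[OF \<phi>] algebra_simps)
  qed
  have inj: "inj_on A l2"
  proof (rule inj_onI)
    fix \<phi> \<eta> assume \<phi>: "\<phi> \<in> l2" and \<eta>: "\<eta> \<in> l2" and "A \<phi> = A \<eta>"
    then have eq: "A \<phi> n = A \<eta> n" for n by simp
    define d where "d = (\<lambda>n. \<phi> n - \<eta> n)"
    have d: "d \<in> l2" unfolding d_def by (rule l2_diff[OF \<phi> \<eta>])
    have "A d = (\<lambda>n. 0)"
    proof
      fix n show "A d n = 0"
        using eq[of n] by (simp add: A_def d_def schroedinger_def algebra_simps)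
    qed
    then have "(cmod z - M) * l2_norm d \<le> 0"
      using below[OF d] by (simp add: l2_norm_def)
    then have "l2_norm d \<le> 0" using M by (simp add: mult_le_0_iff)
    then have "cmod (d n) \<le> 0" for n using cmod_le_l2_norm[OF d, of n] by linarith
    then show "\<phi> = \<eta>" by (auto simp: d_def)
  qed
  have surj: "\<exists>\<phi>\<in>l2. A \<phi> = f" if f: "f \<in> l2" for f
  proof -
    define u where "u = (\<lambda>k. ((\<lambda>\<phi> n. inverse z * schroedinger V \<phi> n) ^^ k) f)"
    define q where "q = M / cmod z"
    have q: "0 \<le> q" "q < 1" using M z by (auto simp: q_def pos_divide_less_eq)
    have u_0: "u 0 = f" by (simp add: u_def)
    have u_Suc: "u (Suc k) n = inverse z * schroedinger V (u k) n" for k n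
      by (simp add: u_def)
    have u: "u k \<in> l2 \<and> l2_norm (u k) \<le> q ^ k * l2_norm f" for k
    proof (induction k)
      case 0
      then show ?case using f by (simp add: u_def)
    next
      case (Suc k)
      then have k: "u k \<in> l2" "l2_norm (u k) \<le> q ^ k * l2_norm f" by auto
      have e: "u (Suc k) = (\<lambda>n. inverse z * schroedinger V (u k) n)"
        using u_Suc by blast
      have "l2_norm (u (Suc k)) = l2_norm (schroedinger V (u k)) / cmod z"
        unfolding e l2_scale(2)[OF H[OF k(1)]] by (simp add: norm_inverse divide_inverse mult.commute)
      also have "\<dots> \<le> M * l2_norm (u k) / cmod z"
        by (intro divide_right_mono bd k) simp
      also have "\<dots> \<le> q * (q ^ k * l2_norm f)"
        using mult_left_mono[OF k(2) q(1)] by (simp add: q_def)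
      finally show ?case
        using l2_scale(1)[OF H[OF k(1)], of "inverse z"] by (simp add: e mult.assoc)
    qed
    have "summable (\<lambda>k. l2_norm (u k))"
    proof (rule summable_comparison_test')
      show "summable (\<lambda>k. q ^ k * l2_norm f)"
        using q by (intro summable_mult2 summable_geometric) auto
      show "norm (l2_norm (u k)) \<le> q ^ k * l2_norm f" for k
        using u[of k] l2_norm_nonneg[of "u k"] by simp
    qed
    note su = l2_suminf[of u, OF conjunct1[OF u] this]
    define S where "S = (\<lambda>n. \<Sum>k. u k n)"
    define \<phi> where "\<phi> = (\<lambda>n. - inverse z * S n)"
    have HS: "schroedinger V S n = z * (S n - f n)" for n
    proof -
      have "(\<lambda>k. u k m) sums S m" for m
        unfolding S_def by (intro summable_sums su)
      then have "(\<lambda>k. u k (n + 1) + u k (n - 1) + of_real (V n) * u k n)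
          sums (S (n + 1) + S (n - 1) + of_real (V n) * S n)"
        by (intro sums_add sums_mult)
      then have "(\<lambda>k. inverse z * schroedinger V (u k) n) sums (inverse z * schroedinger V S n)"
        unfolding schroedinger_def by (rule sums_mult)
      then have "(\<lambda>k. u (Suc k) n) sums (inverse z * schroedinger V S n)"
        by (simp add: u_Suc)
      moreover have "(\<lambda>k. u (Suc k) n) sums (S n - u 0 n)"
        using summable_sums[OF su(1)[of n]] unfolding S_def by (subst sums_Suc_iff) simp
      ultimately have "inverse z * schroedinger V S n = S n - f n"
        by (metis sums_unique2 u_0)
      then show ?thesis using z by (simp add: field_simps)
    qed
    have "A \<phi> n = f n" for n
    proof -
      have "schroedinger V \<phi> n = - inverse z * schroedinger V S n"
        by (simp add: \<phi>_def schroedinger_def algebra_simps)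
      then show ?thesis using z by (simp add: A_def HS \<phi>_def algebra_simps)
    qed
    moreover have "\<phi> \<in> l2" unfolding \<phi>_def S_def by (rule l2_scale(1)[OF su(2)])
    ultimately show ?thesis by blast
  qed
  have "bij_betw A l2 l2"
    unfolding bij_betw_def using inj A_l2 surj by blast
  moreover have "\<forall>\<phi>\<in>l2. l2_norm \<phi> \<le> (1 / (cmod z - M)) * l2_norm (A \<phi>)"
    using below M by (auto simp: field_simps)
  ultimately show ?thesis unfolding l2_resolvent_set_def A_def by blast
qed

section \<open>Positive decaying eigenfunctions\<close>

lemma exponential_bound_l2:
  assumes \<kappa>: "0 < \<kappa>" and bd: "\<And>n. cmod (\<phi> n) \<le> A * exp (- \<kappa> * \<bar>real_of_int n\<bar>)"
  shows "\<phi> \<in> l2"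
proof -
  define q where "q = exp (- 2 * \<kappa>)"
  have q: "0 < q" "q < 1" using \<kappa> by (auto simp: q_def)
  define h where "h = (\<lambda>n::int. A\<^sup>2 * q ^ nat \<bar>n\<bar>)"
  have geo: "(\<lambda>k::nat. A\<^sup>2 * q ^ k) summable_on UNIV"
    using q by (intro summable_on_cmult_right summable_nonneg_imp_summable_on summable_geometric) auto
  have inj: "inj (\<lambda>k::nat. - int k)" by (simp add: inj_on_def)
  have "h summable_on range int"
    using geo by (subst summable_on_reindex) (auto simp: h_def o_def)
  moreover have "h summable_on range (\<lambda>k. - int k)"
    using geo by (subst summable_on_reindex[OF inj]) (auto simp: h_def o_def)
  moreover have "range int \<union> range (\<lambda>k. - int k) = UNIV"
  proof -
    have "x \<in> range int \<union> range (\<lambda>k. - int k)" for x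
      by (cases x rule: int_cases2) auto
    then show ?thesis by blast
  qed
  ultimately have h: "h summable_on UNIV" by (metis summable_on_union)
  have "(cmod (\<phi> n))\<^sup>2 \<le> h n" for n
  proof -
    have "(cmod (\<phi> n))\<^sup>2 \<le> (A * exp (- \<kappa> * \<bar>real_of_int n\<bar>))\<^sup>2"
      by (intro power_mono bd) simp
    also have "\<dots> = h n"
    proof -
      have "(exp (- \<kappa> * \<bar>real_of_int n\<bar>))\<^sup>2 = exp (real (nat \<bar>n\<bar>) * (- 2 * \<kappa>))"
        by (simp add: power2_eq_square flip: exp_add)
      also have "\<dots> = q ^ nat \<bar>n\<bar>" unfolding q_def by (rule exp_of_nat_mult)
      finally show ?thesis by (simp add: h_def power_mult_distrib)
    qed
    finally show ?thesis .
  qed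
  then show ?thesis unfolding l2_def
    by (auto intro: summable_on_comparison_test[OF h])
qed

lemma int_constant:
  fixes f :: "int \<Rightarrow> 'a"
  assumes "\<And>n. f (n + 1) = f n"
  shows "f n = f 0"
proof (induction n rule: int_induct[where k = 0])
  case (step2 i)
  then show ?case using assms[of "i - 1"] by simp
qed (use assms in auto)

text \<open>The Wronskian of two solutions is constant.  Here it vanishes at infinity, since \<open>\<phi>\<close> is bounded
  and \<open>p\<close> tends to 0, and a vanishing Wronskian makes \<open>\<phi> / p\<close> constant.\<close>

lemma eigenfunction_unique:
  fixes p V :: "int \<Rightarrow> real"
  assumes p: "\<And>n. 0 < p n"
    and eq: "\<And>n. p (n + 1) + p (n - 1) + V n * p n = E * p n"
    and lim: "(\<lambda>k. p (int k)) \<longlonglongrightarrow> 0"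
    and \<phi>: "l2_eigenfunction (schroedinger V) (complex_of_real E) \<phi>"
  shows "\<exists>c. c \<noteq> 0 \<and> \<phi> = (\<lambda>n. c * of_real (p n))"
proof -
  have \<phi>_l2: "\<phi> \<in> l2" and nz: "\<phi> \<noteq> (\<lambda>n. 0)"
    and H\<phi>: "schroedinger V \<phi> = (\<lambda>n. complex_of_real E * \<phi> n)"
    using \<phi> unfolding l2_eigenfunction_def by blast+
  have \<phi>_eq: "\<phi> (n + 1) + \<phi> (n - 1) + of_real (V n) * \<phi> n = of_real E * \<phi> n" for n
    using fun_cong[OF H\<phi>, of n] by (simp only: schroedinger_def)
  define W where "W = (\<lambda>n. \<phi> (n + 1) * of_real (p n) - \<phi> n * of_real (p (n + 1)))"
  have "W (n + 1) = W n" for n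
  proof -
    have a: "\<phi> (n + 2) = of_real E * \<phi> (n + 1) - of_real (V (n + 1)) * \<phi> (n + 1) - \<phi> n"
      using \<phi>_eq[of "n + 1"] by (simp add: algebra_simps)
    have b: "p (n + 2) = E * p (n + 1) - V (n + 1) * p (n + 1) - p n"
      using eq[of "n + 1"] by (simp add: algebra_simps)
    show ?thesis unfolding W_def by (simp add: add.assoc a b algebra_simps)
  qed
  note const = int_constant[of W, OF this]
  have "(\<lambda>k. W (int k)) \<longlonglongrightarrow> 0"
  proof (rule Lim_null_comparison)
    show "\<forall>\<^sub>F k in sequentially. norm (W (int k))
        \<le> l2_norm \<phi> * p (int k) + l2_norm \<phi> * p (int (Suc k))"
    proof (rule always_eventually, rule allI)
      fix k
      have "norm (W (int k)) \<le> norm (\<phi> (int k + 1)) * p (int k) + norm (\<phi> (int k)) * p (int k + 1)"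
        unfolding W_def using p[of "int k"] p[of "int k + 1"]
        by (intro order_trans[OF norm_triangle_ineq4]) (simp add: norm_mult)
      also have "\<dots> \<le> l2_norm \<phi> * p (int k) + l2_norm \<phi> * p (int k + 1)"
        by (intro add_mono mult_right_mono cmod_le_l2_norm \<phi>_l2 less_imp_le[OF p])
      finally show "norm (W (int k)) \<le> l2_norm \<phi> * p (int k) + l2_norm \<phi> * p (int (Suc k))"
        by (simp add: add.commute)
    qed
    show "(\<lambda>k. l2_norm \<phi> * p (int k) + l2_norm \<phi> * p (int (Suc k))) \<longlonglongrightarrow> 0"
      using tendsto_add[OF tendsto_mult_left[OF lim, of "l2_norm \<phi>"]
          tendsto_mult_left[OF LIMSEQ_Suc[OF lim], of "l2_norm \<phi>"]] by simp
  qed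
  moreover have "(\<lambda>k. W (int k)) = (\<lambda>k. W 0)" using const by auto
  ultimately have "W 0 = 0" by (simp add: LIMSEQ_const_iff)
  then have W0: "W n = 0" for n using const by simp
  define c where "c = (\<lambda>n. \<phi> n / of_real (p n))"
  have "c (n + 1) = c n" for n
    using W0[of n] p[of n] p[of "n + 1"] by (simp add: W_def c_def field_simps)
  note c_const = int_constant[of c, OF this]
  have "\<phi> n = c 0 * of_real (p n)" for n
  proof -
    have "\<phi> n = c n * of_real (p n)" using p[of n] by (simp add: c_def)
    then show ?thesis by (simp only: c_const[of n])
  qed
  then have \<phi>_c: "\<phi> = (\<lambda>n. c 0 * of_real (p n))" by blast
  moreover have "c 0 \<noteq> 0"
  proof
    assume "c 0 = 0"
    then show False using nz by (subst (asm) \<phi>_c) simp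
  qed
  ultimately show ?thesis by blast
qed

text \<open>A positive exponentially decaying solution is the ground state: it determines the top of
  the spectrum and spans its eigenspace.\<close>

lemma positive_decaying_solution_top:
  fixes p V :: "int \<Rightarrow> real"
  assumes p: "\<And>n. 0 < p n" and V: "\<And>n. 0 \<le> V n"
    and eq: "\<And>n. p (n + 1) + p (n - 1) + V n * p n = E * p n"
    and A: "0 < A" and \<kappa>: "0 < \<kappa>"
    and bd: "\<And>n. p n \<le> A * exp (- \<kappa> * \<bar>real_of_int n\<bar>)"
  shows "max_energy (schroedinger V) E"
    and "l2_eigenvalue (schroedinger V) (complex_of_real E)"
    and "\<And>\<psi>. l2_eigenfunction (schroedinger V) (complex_of_real E) \<psi> \<Longrightarrow>
           exponentially_decaying \<psi> \<and> positive_up_to_constant \<psi>"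
proof -
  define \<psi>0 where "\<psi>0 = (\<lambda>n. complex_of_real (p n))"
  have norm0: "cmod (\<psi>0 n) = p n" for n using p[of n] by (simp add: \<psi>0_def)
  have \<psi>0_l2: "\<psi>0 \<in> l2"
    by (rule exponential_bound_l2[OF \<kappa>]) (use norm0 bd in auto)
  have \<psi>0_nz: "\<psi>0 \<noteq> (\<lambda>n. 0)" using norm0 p by (metis less_irrefl norm_zero)
  have H0: "schroedinger V \<psi>0 = (\<lambda>n. complex_of_real E * \<psi>0 n)"
  proof
    fix n show "schroedinger V \<psi>0 n = complex_of_real E * \<psi>0 n"
      using arg_cong[OF eq[of n], of complex_of_real] by (simp add: schroedinger_def \<psi>0_def)
  qed
  have ef: "l2_eigenfunction (schroedinger V) (complex_of_real E) \<psi>0"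
    unfolding l2_eigenfunction_def using \<psi>0_l2 \<psi>0_nz H0 by simp
  then show "l2_eigenvalue (schroedinger V) (complex_of_real E)"
    unfolding l2_eigenvalue_def by blast
  have E: "0 < E"
  proof -
    have "0 < E * p 0" using p[of 1] p[of "-1"] V[of 0] p[of 0] eq[of 0]
      by (smt (verit) add_0 diff_0 mult_nonneg_nonneg)
    then show ?thesis using p[of 0] by (simp add: zero_less_mult_iff)
  qed
  show "max_energy (schroedinger V) E"
    unfolding max_energy_def
  proof
    have "\<not> inj_on (\<lambda>\<psi> n. schroedinger V \<psi> n - complex_of_real E * \<psi> n) l2"
    proof
      assume inj: "inj_on (\<lambda>\<psi> n. schroedinger V \<psi> n - complex_of_real E * \<psi> n) l2"
      have "\<psi>0 = (\<lambda>n. 0)"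
        by (rule inj_onD[OF inj _ \<psi>0_l2 l2_zero]) (simp add: H0, simp add: schroedinger_def)
      then show False using \<psi>0_nz by simp
    qed
    then show "complex_of_real E \<in> l2_spectrum (schroedinger V)"
      unfolding l2_spectrum_def l2_resolvent_set_def bij_betw_def by simp
    show "\<forall>z\<in>l2_spectrum (schroedinger V). Re z \<le> E"
    proof (rule ballI, rule ccontr)
      fix z assume z: "z \<in> l2_spectrum (schroedinger V)" and "\<not> Re z \<le> E"
      then have "E < cmod z" using complex_Re_le_cmod[of z] by linarith
      then have "z \<in> l2_resolvent_set (schroedinger V)"
        using schur_test[of p V E, OF p V less_imp_le[OF E] eq] E
        by (intro resolvent_outside_norm_disc[where M = E]) auto
      then show False using z by (simp add: l2_spectrum_def)
    qed
  qed
  fix \<psi> assume \<psi>: "l2_eigenfunction (schroedinger V) (complex_of_real E) \<psi>"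
  have lim: "(\<lambda>k. p (int k)) \<longlonglongrightarrow> 0"
  proof (rule Lim_null_comparison)
    show "\<forall>\<^sub>F k in sequentially. norm (p (int k)) \<le> A * exp (- \<kappa>) ^ k"
      using bd[of "int k" for k] p
      by (intro always_eventually allI) (simp add: abs_of_pos mult.commute flip: exp_of_nat_mult)
    show "(\<lambda>k. A * exp (- \<kappa>) ^ k) \<longlonglongrightarrow> 0"
      using \<kappa> by (intro tendsto_mult_right_zero LIMSEQ_power_zero) simp
  qed
  obtain c where c: "c \<noteq> 0" "\<psi> = (\<lambda>n. c * of_real (p n))"
    using eigenfunction_unique[OF p eq lim \<psi>] by blast
  have "cmod (\<psi> n) \<le> (cmod c * A) * exp (- \<kappa> * \<bar>real_of_int n\<bar>)" for n
    using mult_left_mono[OF bd[of n], of "cmod c"] p[of n] by (simp add: c norm_mult)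
  moreover have "0 < cmod c * A" using c A by simp
  ultimately have "exponentially_decaying \<psi>"
    unfolding exponentially_decaying_def using \<kappa> by blast
  moreover have "positive_up_to_constant \<psi>"
    unfolding positive_up_to_constant_def using c p by blast
  ultimately show "exponentially_decaying \<psi> \<and> positive_up_to_constant \<psi>" by simp
qed

section \<open>Steering the ratios\<close>

definition greedy_choice :: "real \<Rightarrow> real \<Rightarrow> real \<Rightarrow> real \<Rightarrow> real" where
  "greedy_choice E a lam r = (if E - 1 / r \<le> a + lam then 0 else lam)"

text \<open>The index is shifted by one against the sites: \<open>ratio E a lam k\<close> stands for
  \<open>\<psi>(k) / \<psi>(k - 1)\<close>.\<close>

primrec ratio :: "real \<Rightarrow> real \<Rightarrow> real \<Rightarrow> nat \<Rightarrow> real" where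
  "ratio E a lam 0 = 1 / a"
| "ratio E a lam (Suc k) =
     E - greedy_choice E a lam (ratio E a lam k) - 1 / ratio E a lam k"

lemma sum_inverse_ge_2:
  fixes r :: real
  assumes "0 < r"
  shows "2 \<le> r + 1 / r"
proof -
  have "0 \<le> (r - 1)\<^sup>2 / r" using assms by simp
  also have "(r - 1)\<^sup>2 / r = r + 1 / r - 2"
    using assms by (simp add: power2_eq_square field_simps)
  finally show ?thesis by simp
qed

lemma sum_inverse_le:
  fixes r :: real
  assumes "0 < a" "a \<le> r" "r \<le> 1 / a"
  shows "r + 1 / r \<le> a + 1 / a"
proof -
  have "0 \<le> (r - a) * (1 / a - r) / r" using assms by simp
  also have "\<dots> = a + 1 / a - (r + 1 / r)"
    using assms by (simp add: field_simps)
  finally show ?thesis by simp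
qed

text \<open>The lower bound \<open>a\<close> and the descent by \<open>\<delta> = 2 + \<lambda> - E\<close> per step leave no room for the ratio to
  stay above \<open>a + \<lambda>\<close> forever; and once at most \<open>a + \<lambda>\<close>, it remains so, as a step either lands there by
  the choice of the potential or decreases the ratio.\<close>

lemma ratio_trapped:
  fixes E a lam :: real
  assumes a: "0 < a" "a < 1" and Ea: "a + 1 / a = E" and lam: "0 < lam" and q: "a + lam < 1"
    and E: "E < 2 + lam"
  shows "a \<le> ratio E a lam k" "\<exists>K. \<forall>k\<ge>K. ratio E a lam k \<le> a + lam"
proof -
  let ?r = "ratio E a lam"
  define \<delta> where "\<delta> = 2 + lam - E"
  have \<delta>: "0 < \<delta>" using E by (simp add: \<delta>_def)
  have a1: "1 < 1 / a" using a by simp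
  have step: "a \<le> ?r (Suc k)" "?r (Suc k) \<le> a + lam \<or> ?r (Suc k) \<le> ?r k - \<delta>"
    if "a \<le> ?r k" "?r k \<le> 1 / a" for k
  proof -
    have r0: "0 < ?r k" using that a by linarith
    have up: "?r k \<le> E - 1 / ?r k"
      using sum_inverse_le[OF a(1) that] Ea by linarith
    have down: "E - lam - 1 / ?r k \<le> ?r k - \<delta>"
      using sum_inverse_ge_2[OF r0] by (simp add: \<delta>_def)
    show "a \<le> ?r (Suc k)" using that up by (simp add: greedy_choice_def)
    show "?r (Suc k) \<le> a + lam \<or> ?r (Suc k) \<le> ?r k - \<delta>"
      using down by (simp add: greedy_choice_def)
  qed
  have range: "a \<le> ?r k \<and> ?r k \<le> 1 / a" for k
  proof (induction k)
    case 0
    then show ?case using a a1 less_imp_le[OF less_trans[OF a(2) a1]] by simp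
  next
    case (Suc k)
    then show ?case using step[of k] \<delta> a1 q by (smt (verit))
  qed
  then show "a \<le> ?r k" by blast
  have descend: "?r k \<le> a + lam \<or> ?r k \<le> 1 / a - real k * \<delta>" for k
  proof (induction k)
    case 0
    then show ?case by simp
  next
    case (Suc k)
    have "real (Suc k) * \<delta> = real k * \<delta> + \<delta>" by (simp add: algebra_simps)
    moreover have "?r (Suc k) \<le> a + lam \<or> ?r (Suc k) \<le> ?r k - \<delta>"
      using step(2) range by blast
    ultimately show ?case using Suc \<delta> by linarith
  qed
  obtain K :: nat where K: "1 / a < real K * \<delta>"
    using reals_Archimedean3[OF \<delta>] by blast
  have "?r k \<le> a + lam" if "K \<le> k" for k
  proof -
    have "real K * \<delta> \<le> real k * \<delta>" using that \<delta> by (simp add: mult_right_mono)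
    then show ?thesis using descend[of k] range[of k] K a by linarith
  qed
  then show "\<exists>K. \<forall>k\<ge>K. ?r k \<le> a + lam" by blast
qed

lemma ex_positive_decaying_solution:
  fixes E a lam :: real
  assumes a: "0 < a" "a < 1" and Ea: "a + 1 / a = E" and lam: "0 < lam" and q: "a + lam < 1"
    and E: "E < 2 + lam"
  obtains V p :: "int \<Rightarrow> real" and A \<kappa> where
    "\<And>n. V n \<in> {0, lam}" "\<And>n. 0 < p n"
    "\<And>n. p (n + 1) + p (n - 1) + V n * p n = E * p n"
    "0 < A" "0 < \<kappa>" "\<And>n. p n \<le> A * exp (- \<kappa> * \<bar>real_of_int n\<bar>)"
proof -
  let ?r = "ratio E a lam"
  note trapped = ratio_trapped[OF assms]
  have r0: "0 < ?r k" for k using trapped(1)[of k] a by linarith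
  define P where "P = (\<lambda>k. \<Prod>j<k. ?r (Suc j))"
  have P_Suc: "P (Suc k) = P k * ?r (Suc k)" for k by (simp add: P_def)
  have P0: "0 < P k" for k unfolding P_def by (intro prod_pos ballI r0)
  define p where "p = (\<lambda>n::int. if 0 \<le> n then P (nat n) else a ^ nat (- n))"
  define V where "V = (\<lambda>n::int. if 0 \<le> n then greedy_choice E a lam (?r (nat n)) else 0)"
  have p_nonpos: "p n = a ^ nat (- n)" if "n \<le> 0" for n
    using that by (auto simp: p_def P_def)
  have p_pos: "0 < p n" for n using P0 a by (simp add: p_def)
  have eq: "p (n + 1) + p (n - 1) + V n * p n = E * p n" for n
  proof (cases "0 \<le> n")
    case True
    define k where "k = nat n"
    have n: "n = int k" using True by (simp add: k_def)
    have prev: "p (n - 1) = p n / ?r k"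
    proof (cases k)
      case 0
      then show ?thesis using n by (simp add: p_def P_def)
    next
      case (Suc j)
      then have "n - 1 = int j" using n by simp
      then show ?thesis using n Suc less_imp_neq[OF r0[of "Suc j"]] P_Suc[of j]
        by (simp add: p_def nat_add_distrib del: ratio.simps)
    qed
    have "p (n + 1) = p n * ?r (Suc k)"
      using n P_Suc[of k] by (simp add: p_def nat_add_distrib del: ratio.simps)
    moreover have "V n = greedy_choice E a lam (?r k)" using n by (simp add: V_def)
    ultimately show ?thesis using prev by (simp add: algebra_simps)
  next
    case False
    define j where "j = nat (- n - 1)"
    have n: "n = - int (Suc j)" using False by (simp add: j_def)
    have "p n = a ^ Suc j" "p (n + 1) = a ^ j" "p (n - 1) = a ^ Suc (Suc j)"
      using n p_nonpos[of n] p_nonpos[of "n + 1"] p_nonpos[of "n - 1"]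
      by (simp_all add: nat_add_distrib)
    moreover have "V n = 0" using n by (simp add: V_def)
    moreover have "E * a ^ Suc j = a ^ j + a ^ Suc (Suc j)"
      unfolding Ea[symmetric] using a by (simp add: field_simps)
    ultimately show ?thesis by simp
  qed
  define b where "b = a + lam"
  have b: "0 < b" "b < 1" "a \<le> b" using a lam q by (auto simp: b_def)
  obtain K where K: "\<And>k. K \<le> k \<Longrightarrow> ?r k \<le> b" using trapped(2) unfolding b_def by blast
  \<comment> \<open>From \<open>K\<close> on, the quotient of \<open>P k\<close> and \<open>b ^ k\<close> is nonincreasing, so its maximum is taken among
    the indices up to \<open>K\<close>.\<close>
  define A where "A = 1 + (\<Sum>j\<le>K. P j / b ^ j)"
  have S0: "0 \<le> (\<Sum>j\<le>K. P j / b ^ j)"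
    by (intro sum_nonneg divide_nonneg_pos less_imp_le[OF P0]) (use b in simp)
  have A1: "1 \<le> A" using S0 by (simp add: A_def)
  have P_bd: "P k \<le> A * b ^ k" for k
  proof (induction k)
    case 0
    then show ?case using A1 by (simp add: P_def)
  next
    case (Suc k)
    show ?case
    proof (cases "Suc k \<le> K")
      case True
      have "P (Suc k) / b ^ Suc k \<le> (\<Sum>j\<le>K. P j / b ^ j)"
        by (rule member_le_sum[of "Suc k" "{..K}" "\<lambda>j. P j / b ^ j"])
          (use True b in \<open>auto intro!: divide_nonneg_pos less_imp_le[OF P0]\<close>)
      then have "P (Suc k) / b ^ Suc k \<le> A" by (simp add: A_def)
      then show ?thesis using b by (simp add: pos_divide_le_eq)
    next
      case False
      then have "P (Suc k) \<le> (A * b ^ k) * b"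
        unfolding P_Suc using Suc K[of "Suc k"] P0[of k] r0[of "Suc k"]
        by (intro mult_mono) (auto intro: less_imp_le order_trans)
      then show ?thesis by (simp add: mult_ac)
    qed
  qed
  define \<kappa> where "\<kappa> = - ln b"
  have \<kappa>: "0 < \<kappa>" using b by (simp add: \<kappa>_def)
  have b_exp: "b ^ nat \<bar>n\<bar> = exp (- \<kappa> * \<bar>real_of_int n\<bar>)" for n
    using b exp_of_nat_mult[of "nat \<bar>n\<bar>" "ln b"] by (simp add: \<kappa>_def mult.commute)
  have bd: "p n \<le> A * exp (- \<kappa> * \<bar>real_of_int n\<bar>)" for n
  proof (cases "0 \<le> n")
    case True
    then show ?thesis using P_bd[of "nat n"] unfolding b_exp[symmetric] by (simp add: p_def)
  next
    case False
    then have "p n \<le> b ^ nat \<bar>n\<bar>"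
      using a b by (simp add: p_nonpos power_mono)
    also have "\<dots> \<le> A * b ^ nat \<bar>n\<bar>" using A1 b by simp
    finally show ?thesis unfolding b_exp .
  qed
  show thesis
    by (rule that[of V p A \<kappa>])
      (use p_pos eq A1 \<kappa> bd in \<open>auto simp: V_def greedy_choice_def\<close>)
qed

text \<open>With the bound \<open>1/3\<close> on \<open>\<lambda>\<close> and \<open>\<epsilon> = \<lambda>/2\<close>, the decaying ratio \<open>a\<close> of the free equation
  satisfies \<open>a + \<lambda> < 1\<close>: the function \<open>x + 1/x\<close> decreases on \<open>(0,1)\<close> and its value
  \<open>2 + \<lambda>\<^sup>2 / (1 - \<lambda>)\<close> at \<open>1 - \<lambda>\<close> lies below \<open>2 + \<lambda>/2 < E\<close>.\<close>

lemma ex_decaying_ratio: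
  fixes E lam :: real
  assumes lam: "0 < lam" "lam < 1 / 3" and E: "2 + lam / 2 < E"
  obtains a where "0 < a" "a < 1" "a + 1 / a = E" "a + lam < 1"
proof -
  define f where "f = (\<lambda>x::real. x * (E - x))"
  have b: "0 < E" "0 < 1 - lam" using lam E by linarith+
  have top: "1 < f (1 - lam)"
  proof -
    have "lam * lam < (lam / 2) * (1 - lam)"
      using mult_strict_left_mono[of lam "(1 - lam) / 2" lam] lam by simp
    then have "1 < (1 - lam) * (2 + lam / 2 - (1 - lam))" by (simp add: algebra_simps)
    also have "\<dots> < f (1 - lam)"
      unfolding f_def using E b by (intro mult_strict_left_mono) auto
    finally show ?thesis .
  qed
  have "\<exists>x\<ge>0. x \<le> 1 - lam \<and> f x = 1"
    using top b by (intro IVT') (auto simp: f_def intro!: continuous_intros)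
  then obtain a where a: "0 \<le> a" "a \<le> 1 - lam" "f a = 1" by blast
  have "a \<noteq> 0" "a \<noteq> 1 - lam" using a top by (auto simp: f_def)
  then have a': "0 < a" "a + lam < 1" using a by auto
  moreover have "a + 1 / a = E" using a(3) a'(1) by (simp add: f_def field_simps)
  ultimately show thesis using that[of a] lam by simp
qed

theorem theorem1p5:
  "\<exists>lam0>0. \<forall>lam::real. 0 < lam \<and> lam < lam0 \<longrightarrow>
     (\<exists>\<epsilon>>0. \<forall>E\<in>{2 + lam - \<epsilon><..<2 + lam}. \<exists>V :: int \<Rightarrow> real.
        (\<forall>n. V n \<in> {0, lam}) \<and>
        max_energy (schroedinger V) E \<and>
        l2_eigenvalue (schroedinger V) (complex_of_real E) \<and>
        (\<forall>\<psi>. l2_eigenfunction (schroedinger V) (complex_of_real E) \<psi> \<longrightarrow>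
             exponentially_decaying \<psi> \<and> positive_up_to_constant \<psi>))"
proof (rule exI[of _ "1 / 3"], intro conjI allI impI)
  fix lam :: real assume lam: "0 < lam \<and> lam < 1 / 3"
  show "\<exists>\<epsilon>>0. \<forall>E\<in>{2 + lam - \<epsilon><..<2 + lam}. \<exists>V :: int \<Rightarrow> real.
        (\<forall>n. V n \<in> {0, lam}) \<and>
        max_energy (schroedinger V) E \<and>
        l2_eigenvalue (schroedinger V) (complex_of_real E) \<and>
        (\<forall>\<psi>. l2_eigenfunction (schroedinger V) (complex_of_real E) \<psi> \<longrightarrow>
             exponentially_decaying \<psi> \<and> positive_up_to_constant \<psi>)"
  proof (rule exI[of _ "lam / 2"], intro conjI ballI)
    fix E assume "E \<in> {2 + lam - lam / 2<..<2 + lam}"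
    then have E: "2 + lam / 2 < E" "E < 2 + lam" by auto
    obtain a where a: "0 < a" "a < 1" "a + 1 / a = E" "a + lam < 1"
      using ex_decaying_ratio[of lam E] lam E by blast
    obtain V p A \<kappa> where *: "\<And>n. V n \<in> {0, lam}" "\<And>n. 0 < p n"
      "\<And>n. p (n + 1) + p (n - 1) + V n * p n = E * p n"
      "0 < A" "0 < \<kappa>" "\<And>n. p n \<le> A * exp (- \<kappa> * \<bar>real_of_int n\<bar>)"
      by (rule ex_positive_decaying_solution[OF a(1-3) conjunct1[OF lam] a(4) E(2)]) (rule that)
    have V: "0 \<le> V n" for n using *(1)[of n] lam by auto
    note top = positive_decaying_solution_top[OF *(2) V *(3-6)]
    show "\<exists>V :: int \<Rightarrow> real.
        (\<forall>n. V n \<in> {0, lam}) \<and>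
        max_energy (schroedinger V) E \<and>
        l2_eigenvalue (schroedinger V) (complex_of_real E) \<and>
        (\<forall>\<psi>. l2_eigenfunction (schroedinger V) (complex_of_real E) \<psi> \<longrightarrow>
             exponentially_decaying \<psi> \<and> positive_up_to_constant \<psi>)"
      by (intro exI[of _ V] conjI allI impI *(1) top)
  qed (use lam in simp)
qed simp

end
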